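(* Let $A$ be an $n$-by-$n$ reciprocal matrix that is not consistent. If $w\in\mathcal{E}(A)$ and $\mathcal{C}$ is a Hamiltonian cycle in $G(A,w)$, then $\mathcal{C}\in\pi_1(A)$. Conversely, if $\mathcal{C}\in\pi_1(A)$, then $\varepsilon_A(\mathcal{C})=\{w: G(A,w)\text{ contains }\mathcal{C}\}$ is a nonempty convex subset of $\mathcal{E}(A)$. Moreover, $$\mathcal{E}(A)=\bigcup_{\mathcal{C}\in\pi_{<1}(A)}\varepsilon_A(\mathcal{C}).$$
   Context: An $n$-by-$n$ matrix $A=[a_{ij}]$ is reciprocal if all its entries are positive and $a_{ji}=1/a_{ij}$; it is consistent if $A=[w_i/w_j]$ for some entry-wise positive $w$. $\mathbb{R}^n_+$ is the set of entry-wise positive vectors. A vector $w\in\mathbb{R}^n_+$ is efficient for $A$ if, for $v\in\mathbb{R}^n_+$, $|a_{ij}-v_i/v_j|\le|a_{ij}-w_i/w_j|$ for all $i,j$ implies $v$ is a positive multiple of $w$; $\mathcal{E}(A)$ is the set of efficient vectors. For $w\in\mathbb{R}^n_+$, $G(A,w)$ is the digraph on $\{1,\dots,n\}$ with an edge $i\to j$ ($i\ne j$) iff $w_i\ge a_{ij}w_j$. For a Hamiltonian cycle $\mathcal{C}:\gamma_1\to\cdots\to\gamma_n\to\gamma_1$, its cycle product in $A$ is $a_{\gamma_n\gamma_1}\prod_{i=1}^{n-1}a_{\gamma_i\gamma_{i+1}}$; $\pi_1(A)$ (resp. $\pi_{<1}(A)$) is the set of Hamiltonian cycles with cycle product $\le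 1$ (resp. $<1$); $\varepsilon_A(\mathcal{C})$ is the set of $w\in\mathbb{R}^n_+$ such that $G(A,w)$ contains $\mathcal{C}$. *)

theory Defs
  imports "HOL-Analysis.Analysis" "Graph_Theory.Pair_Digraph"
begin

definition positive_vectors :: "(real ^ 'n) set" where
  "positive_vectors = {w. \<forall>i. w $ i > 0}"

definition reciprocal_matrix :: "real ^ 'n ^ 'n \<Rightarrow> bool" where
  "reciprocal_matrix A \<longleftrightarrow> (\<forall>i j. A $ i $ j > 0 \<and> A $ j $ i = 1 / A $ i $ j)"

definition consistent_matrix :: "real ^ 'n ^ 'n \<Rightarrow> bool" where
  "consistent_matrix A \<longleftrightarrow> (\<exists>w\<in>positive_vectors. A = (\<chi> i j. w $ i / w $ j))"

definition efficient_vectors :: "real ^ 'n ^ 'n \<Rightarrow> (real ^ 'n) set" where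
  "efficient_vectors A = {w \<in> positive_vectors. \<forall>v\<in>positive_vectors.
     (\<forall>i j. \<bar>A $ i $ j - v $ i / v $ j\<bar> \<le> \<bar>A $ i $ j - w $ i / w $ j\<bar>)
       \<longrightarrow> (\<exists>c>0. v = c *\<^sub>R w)}"

definition efficiency_digraph :: "real ^ 'n ^ 'n \<Rightarrow> real ^ 'n \<Rightarrow> 'n pair_pre_digraph" where
  "efficiency_digraph A w =
     \<lparr>pverts = UNIV, parcs = {(i, j). i \<noteq> j \<and> w $ i \<ge> A $ i $ j * w $ j}\<rparr>"

definition full_digraph :: "'n pair_pre_digraph" where
  "full_digraph = \<lparr>pverts = UNIV, parcs = {(i, j). i \<noteq> j}\<rparr>"

text \<open>
  A cycle \<open>\<gamma>\<^sub>1 \<rightarrow> \<dots> \<rightarrow> \<gamma>\<^sub>n \<rightarrow> \<gamma>\<^sub>1\<close> is the list of its arcs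
  \<open>[(\<gamma>\<^sub>1, \<gamma>\<^sub>2), \<dots>, (\<gamma>\<^sub>n, \<gamma>\<^sub>1)]\<close>, so the \<open>n\<close> choices of the starting vertex
  give \<open>n\<close> representations of the same cycle.  Cycle products and the sets
  \<open>cycle_vectors\<close> below do not depend on that choice.
\<close>

definition hamiltonian_cycle :: "'a pair_pre_digraph \<Rightarrow> ('a \<times> 'a) awalk \<Rightarrow> bool" where
  "hamiltonian_cycle G C \<longleftrightarrow>
     pre_digraph.cycle (with_proj G) C \<and> fst ` set C = pverts G"

definition cycle_product :: "real ^ 'n ^ 'n \<Rightarrow> ('n \<times> 'n) awalk \<Rightarrow> real" where
  "cycle_product A C = (\<Prod>(i, j)\<leftarrow>C. A $ i $ j)"

definition cycles_le_one :: "real ^ 'n ^ 'n \<Rightarrow> ('n \<times> 'n) awalk set" where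
  "cycles_le_one A = {C. hamiltonian_cycle full_digraph C \<and> cycle_product A C \<le> 1}"

definition cycles_less_one :: "real ^ 'n ^ 'n \<Rightarrow> ('n \<times> 'n) awalk set" where
  "cycles_less_one A = {C. hamiltonian_cycle full_digraph C \<and> cycle_product A C < 1}"

definition cycle_vectors :: "real ^ 'n ^ 'n \<Rightarrow> ('n \<times> 'n) awalk \<Rightarrow> (real ^ 'n) set" where
  "cycle_vectors A C =
     {w \<in> positive_vectors. set C \<subseteq> parcs (efficiency_digraph A w)}"

end

theory Submission
  imports Defs
begin

text \<open>
  A vector is efficient iff its digraph is strongly connected, and by reciprocity this digraph is a total
  relation, so Camion's theorem provides a Hamiltonian cycle; multiplying \<open>a\<^sub>i\<^sub>j \<le> w\<^sub>i / w\<^sub>j\<close> around it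
  shows that its product is at most 1.  To get a product below 1, the cycle must contain a strict arc.  As
  \<open>A\<close> is not consistent, some cycle contains one, and a longest such cycle is Hamiltonian:
  a vertex \<open>x\<close> that cannot be inserted without destroying the strict arc either strictly dominates the
  cycle or is strictly dominated by it, and an arc \<open>s \<rightarrow> t\<close> from a dominated vertex to a dominating one
  could be inserted as a detour, again with a strict arc.
\<close>

section \<open>Strict Hamiltonian paths in strongly connected total relations\<close>

text \<open>A new start vertex that already occurs on the path cuts it back to that occurrence, so
  the path stays simple. With \<open>\<not> R a b\<close>, the path from \<open>a\<close> to
  \<open>b\<close> is the initial strict cycle.\<close>

lemma rtranclp_distinct_path:
  assumes "R\<^sup>*\<^sup>* a b"
  shows "\<exists>xs. xs \<noteq> [] \<and> hd xs = a \<and> last xs = b \<and> distinct xs \<and> successively R xs"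
  using assms
proof (induction rule: converse_rtranclp_induct)
  case base
  show ?case by (rule exI[of _ "[b]"]) simp
next
  case (step a y)
  then obtain xs where xs: "xs \<noteq> []" "hd xs = y" "last xs = b" "distinct xs" "successively R xs"
    by blast
  show ?case
  proof (cases "a \<in> set xs")
    case True
    then obtain ys zs where "xs = ys @ a # zs" by (meson split_list)
    with xs show ?thesis
      by (intro exI[of _ "a # zs"]) (auto simp: successively_append_iff)
  next
    case False
    with xs step.hyps show ?thesis
      by (intro exI[of _ "a # xs"]) (auto simp: successively_Cons)
  qed
qed

text \<open>
  For a total relation, \<open>\<not> R x y\<close> is the strict part of \<open>R y x\<close>.  A list that satisfies
  \<open>strict_cycle R\<close> is thus a cycle, written so that its closing arc, from last to first element, is strict.
\<close>

definition strict_cycle :: "('a \<Rightarrow> 'a \<Rightarrow> bool) \<Rightarrow> 'a list \<Rightarrow> bool" where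
  "strict_cycle R xs \<longleftrightarrow>
     xs \<noteq> [] \<and> distinct xs \<and> successively R xs \<and> \<not> R (hd xs) (last xs)"

text \<open>Domination of \<open>x\<close> propagates: given \<open>R p x\<close>,
  \<open>no_insert\<close> rules out \<open>R x q\<close> for the next vertex \<open>q\<close>, and
  totality then gives \<open>R q x\<close>. The head is left out, having no predecessor in the
  list.\<close>

lemma successively_dominates_all:
  assumes total: "\<And>i j. R i j \<or> R j i"
    and "successively R xs" "xs \<noteq> []" "R (hd xs) x"
    and no_insert: "\<And>ys p q zs. xs = ys @ p # q # zs \<Longrightarrow> \<not> (R p x \<and> R x q)"
  shows "\<forall>y\<in>set (tl xs). \<not> R x y"
  using assms(2-)
proof (induction xs)
  case (Cons p xs)
  show ?case
  proof (cases xs)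
    case (Cons q zs)
    have "\<not> R x q" using Cons.prems(3) Cons.prems(4)[of "[]" p q zs] Cons by simp
    moreover from this have "R q x" using total by blast
    moreover have "\<not> (R p' x \<and> R x q')" if "xs = ys @ p' # q' # zs'" for ys p' q' zs'
      using Cons.prems(4)[of "p # ys"] that by simp
    ultimately show ?thesis
      using Cons.IH Cons.prems Cons by (auto simp: successively_Cons)
  qed simp
qed simp

text \<open>Inserting \<open>x\<close> inside the list keeps the strict closing arc, so maximality
  supplies \<open>no_insert\<close>. If \<open>R (hd xs) x\<close>, domination spreads forward from
  the head; otherwise the dual argument runs backward from the last vertex.\<close>

lemma strict_cycle_insert:
  assumes total: "\<And>i j. R i j \<or> R j i"
    and xs: "strict_cycle R xs" and x: "x \<notin> set xs"
    and maximal: "\<And>ys. strict_cycle R ys \<Longrightarrow> length ys \<le> length xs"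
  shows "(\<forall>y\<in>set xs. \<not> R x y) \<or> (\<forall>y\<in>set xs. \<not> R y x)"
proof -
  have ne: "xs \<noteq> []" and dist: "distinct xs" and succ: "successively R xs"
    and strict: "\<not> R (hd xs) (last xs)"
    using xs by (auto simp: strict_cycle_def)
  have refl: "R i i" for i using total by blast
  have tl_ne: "tl xs \<noteq> []"
    using ne strict refl by (cases xs) auto
  have last_tl: "last xs \<in> set (tl xs)"
    using tl_ne by (cases xs) auto
  have no_insert: "\<not> (R p x \<and> R x q)" if "xs = ys @ p # q # zs" for ys p q zs
  proof
    assume "R p x \<and> R x q"
    then have "strict_cycle R (ys @ p # x # q # zs)"
      using xs x that by (auto simp: strict_cycle_def successively_append_iff successively_Cons hd_append split: if_splits)
    from maximal[OF this] that show False by simp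
  qed
  show ?thesis
  proof (cases "R (hd xs) x")
    case True
    have dom: "\<forall>y\<in>set (tl xs). \<not> R x y"
      by (rule successively_dominates_all[OF total succ ne True no_insert])
    \<comment> \<open>Prepending \<open>x\<close> makes the arc from \<open>last xs\<close> to
      \<open>x\<close> the closing one; it is strict because \<open>last xs\<close> lies in the
      tail.\<close>
    have "\<not> R x (hd xs)"
    proof
      assume "R x (hd xs)"
      then have "strict_cycle R (x # xs)"
        using ne dist succ x dom last_tl by (auto simp: strict_cycle_def successively_Cons)
      from maximal[OF this] show False by simp
    qed
    with dom ne show ?thesis by (cases xs) auto
  next
    case False
    have "\<not> R (last xs) x"
    proof
      assume "R (last xs) x"
      then have "strict_cycle R (xs @ [x])"
        using ne dist succ x False by (auto simp: strict_cycle_def successively_append_iff)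
      from maximal[OF this] show False by simp
    qed
    then have "R x (last xs)" using total by blast
    \<comment> \<open>The same propagation for the converse relation along the reversed
      list.\<close>
    have "\<forall>y\<in>set (tl (rev xs)). \<not> R y x"
    proof (rule successively_dominates_all[where R = "\<lambda>i j. R j i"])
      show "\<not> (R x p \<and> R q x)" if "rev xs = ys @ p # q # zs" for ys p q zs
      proof -
        have "xs = rev zs @ q # p # rev ys" using arg_cong[OF that, of rev] by simp
        then show ?thesis using no_insert by blast
      qed
    qed (use total succ ne \<open>R x (last xs)\<close> in \<open>auto simp: hd_rev\<close>)
    moreover have "set xs = insert (last xs) (set (tl (rev xs)))"
      using ne by (cases xs rule: rev_cases) auto
    ultimately show ?thesis using \<open>\<not> R (last xs) x\<close> by auto
  qed
qed

lemma strongly_connected_total_strict_hamiltonian: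
  fixes R :: "'a :: finite \<Rightarrow> 'a \<Rightarrow> bool"
  assumes total: "\<And>i j. R i j \<or> R j i"
    and connected: "\<And>i j. R\<^sup>*\<^sup>* i j"
    and strict: "\<not> R a b"
  shows "\<exists>xs. strict_cycle R xs \<and> set xs = UNIV"
proof -
  obtain xs0 where "strict_cycle R xs0"
    using rtranclp_distinct_path[OF connected[of a b]] strict by (auto simp: strict_cycle_def)
  moreover have "\<forall>xs. strict_cycle R xs \<longrightarrow> length xs < Suc (card (UNIV :: 'a set))"
  proof (intro allI impI)
    fix xs assume "strict_cycle R xs"
    then have "length xs = card (set xs)" by (simp add: strict_cycle_def distinct_card)
    then show "length xs < Suc (card (UNIV :: 'a set))" by (simp add: card_mono less_Suc_eq_le)
  qed
  ultimately obtain xs where xs: "strict_cycle R xs"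
    and maximal: "\<And>ys. strict_cycle R ys \<Longrightarrow> length ys \<le> length xs"
    using ex_has_greatest_nat[of "strict_cycle R" xs0 length] by blast
  have ne: "xs \<noteq> []" and dist: "distinct xs" and succ: "successively R xs"
    using xs by (auto simp: strict_cycle_def)
  have refl: "R i i" for i using total by blast
  have "x \<in> set xs" for x
  proof (rule ccontr)
    assume x: "x \<notin> set xs"
    define S where "S = {s. \<forall>y\<in>set xs. \<not> R s y}"
    define T where "T = {t. \<forall>y\<in>set xs. \<not> R y t}"
    have outside: "z \<in> set xs \<or> z \<in> S \<or> z \<in> T" for z
      using strict_cycle_insert[OF total xs _ maximal, of z] by (auto simp: S_def T_def)
    have no_arc: "\<not> R s t" if "s \<in> S" "t \<in> T" for s t
    proof
      assume "R s t"
      moreover have last: "\<not> R s (last xs)" and hd: "\<not> R (hd xs) t"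
        using that ne by (auto simp: S_def T_def)
      moreover from hd have "R t (hd xs)" using total by blast
      moreover have "s \<notin> set xs" "t \<notin> set xs"
        using that total by (auto simp: S_def T_def)
      moreover have "s \<noteq> t"
        using last that ne total[of s "last xs"] by (auto simp: T_def)
      \<comment> \<open>This cycle replaces the closing arc by the detour through \<open>s\<close>
        and \<open>t\<close>; its own closing arc, from \<open>last xs\<close> to \<open>s\<close>,
        is strict.\<close>
      ultimately have "strict_cycle R (s # t # xs)"
        using ne dist succ by (auto simp: strict_cycle_def successively_Cons)
      from maximal[OF this] show False by simp
    qed
    have hd: "hd xs \<in> set xs" using ne by simp
    show False
    proof (cases "x \<in> S")
      case True
      \<comment> \<open>No arc leads from \<open>S\<close> to the cycle or to \<open>T\<close>, so
        \<open>S\<close> cannot be left.\<close>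
      have "y \<in> S" if "R\<^sup>*\<^sup>* x y" for y
        using that
      proof induction
        case (step y z)
        then have "z \<notin> set xs" by (auto simp: S_def)
        moreover have "z \<notin> T" using no_arc step by blast
        ultimately show ?case using outside by blast
      qed (fact True)
      then have "hd xs \<in> S" using connected by blast
      then show False using hd refl by (auto simp: S_def)
    next
      case False
      then have "x \<in> T" using outside x by blast
      \<comment> \<open>Neither the cycle nor \<open>S\<close> has an arc into \<open>T\<close>, so
        \<open>T\<close> cannot be entered.\<close>
      have "y \<notin> T" if "R\<^sup>*\<^sup>* (hd xs) y" for y
        using that
      proof induction
        case base
        show ?case using hd refl by (auto simp: T_def)
      next
        case (step y z)
        then have "y \<in> set xs \<or> y \<in> S" using outside by blast
        then show ?case
        proof
          assume "y \<in> set xs"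
          with step show ?thesis by (auto simp: T_def)
        next
          assume "y \<in> S"
          with step show ?thesis using no_arc by blast
        qed
      qed
      then show False using connected \<open>x \<in> T\<close> by blast
    qed
  qed
  with xs show ?thesis by blast
qed

section \<open>Cycles as arc lists\<close>

lemma zip_rotate1:
  assumes "xs \<noteq> []"
  shows "zip xs (rotate1 xs) = zip xs (tl xs) @ [(last xs, hd xs)]"
proof -
  have "zip (x # ys) (ys @ [a]) = zip (x # ys) ys @ [(last (x # ys), a)]" for x a :: 'a and ys
    by (induction ys arbitrary: x) auto
  with assms show ?thesis by (cases xs) auto
qed

lemma set_zip_tl_iff_successively:
  "(\<forall>(x, y)\<in>set (zip xs (tl xs)). R x y) \<longleftrightarrow> successively R xs"
  by (induction xs rule: induct_list012) auto

lemma pcas_iff: "pcas u p v \<longleftrightarrow> u # map snd p = map fst p @ [v]"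
  by (induction p arbitrary: u) auto

lemma pawalk_verts_pcas: "pcas u p v \<Longrightarrow> pawalk_verts u p = u # map snd p"
  by (induction p arbitrary: u) auto

text \<open>In a closed walk the list of arc heads is the list of arc tails rotated once, so the
  walk can be handled through its vertex list \<open>xs\<close>.\<close>

lemma hamiltonian_cycle_iff:
  assumes "pverts G = UNIV"
  shows "hamiltonian_cycle G C \<longleftrightarrow>
    (\<exists>xs. xs \<noteq> [] \<and> distinct xs \<and> set xs = UNIV \<and> C = zip xs (rotate1 xs) \<and> set C \<subseteq> parcs G)"
    (is "?L \<longleftrightarrow> ?R")
proof -
  have L: "?L \<longleftrightarrow> (\<exists>u. set C \<subseteq> parcs G \<and> u # map snd C = map fst C @ [u] \<and> distinct (map snd C)
      \<and> C \<noteq> [] \<and> set (map fst C) = UNIV)"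
    using assms pawalk_verts_pcas[of _ C]
    unfolding hamiltonian_cycle_def pre_digraph.cycle_def pre_digraph.awalk_def
      cas_with_proj_eq awalk_verts_with_proj_eq pcas_iff[symmetric]
    by auto
  show ?thesis
  proof
    assume ?L
    then obtain u where C: "set C \<subseteq> parcs G" "u # map snd C = map fst C @ [u]"
      "distinct (map snd C)" "C \<noteq> []" "set (map fst C) = UNIV"
      using L by blast
    have rot: "map snd C = rotate1 (map fst C)"
      using C(2,4) by (cases C) auto
    have "C = zip (map fst C) (rotate1 (map fst C))"
      by (simp add: zip_map_fst_snd flip: rot)
    moreover have "distinct (map fst C)" using C(3) unfolding rot by simp
    ultimately show ?R using C by (intro exI[of _ "map fst C"]) simp
  next
    assume ?R
    then obtain xs where xs: "xs \<noteq> []" "distinct xs" "set xs = UNIV" "C = zip xs (rotate1 xs)"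
      "set C \<subseteq> parcs G" by blast
    then have "map fst C = xs" "map snd C = rotate1 xs" by simp_all
    then show ?L
      unfolding L using xs by (intro exI[of _ "hd xs"]) (cases xs; auto)
  qed
qed

section \<open>Products over arcs and weights along a path\<close>

lemma prod_list_zip_divide:
  fixes f :: "'a \<Rightarrow> 'b :: field"
  assumes "length xs = length ys"
  shows "(\<Prod>(i, j)\<leftarrow>zip xs ys. f i / f j) = prod_list (map f xs) / prod_list (map f ys)"
  using assms by (induction xs ys rule: list_induct2) auto

text \<open>Numerators and denominators are the same entries up to rotation, so they cancel.\<close>

lemma prod_list_cycle_quotients:
  fixes f :: "'a \<Rightarrow> 'b :: field"
  assumes "\<And>i. f i \<noteq> 0"
  shows "(\<Prod>(i, j)\<leftarrow>zip xs (rotate1 xs). f i / f j) = 1"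
proof -
  have "prod_list (map f (rotate1 xs)) = prod_list (map f xs)"
    by (cases xs) (auto simp: mult.commute)
  moreover have "prod_list (map f xs) \<noteq> 0" using assms by (induction xs) auto
  ultimately show ?thesis by (simp add: prod_list_zip_divide)
qed

lemma prod_list_pos:
  fixes f :: "'a \<Rightarrow> real"
  assumes "\<And>x. x \<in> set xs \<Longrightarrow> 0 < f x"
  shows "0 < prod_list (map f xs)"
  using assms by (induction xs) auto

lemma prod_list_mono_real:
  fixes f g :: "'a \<Rightarrow> real"
  assumes "\<And>x. x \<in> set xs \<Longrightarrow> 0 < f x \<and> f x \<le> g x"
  shows "prod_list (map f xs) \<le> prod_list (map g xs)"
  using assms
proof (induction xs)
  case (Cons x xs)
  have "0 < prod_list (map f xs)" by (rule prod_list_pos) (use Cons.prems in auto)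
  moreover have "0 < g x" using Cons.prems[of x] by auto
  ultimately show ?case using Cons by (auto intro!: mult_mono)
qed simp

text \<open>
  The weights of a path are realised exactly by fixing the last weight as 1 and working backwards; the first
  weight is then the product of all entries, so the closing arc costs exactly the cycle product.
\<close>

lemma path_weights:
  fixes a :: "'a \<Rightarrow> 'a \<Rightarrow> real"
  assumes pos: "\<And>i j. 0 < a i j" and "xs \<noteq> []" "distinct xs"
  shows "\<exists>f. (\<forall>i. 0 < f i) \<and> successively (\<lambda>i j. f i = a i j * f j) xs \<and> f (last xs) = 1
    \<and> f (hd xs) = (\<Prod>(i, j)\<leftarrow>zip xs (tl xs). a i j)"
  using assms(2-)
proof (induction xs rule: induct_list012)
  case (2 x)
  show ?case by (rule exI[of _ "\<lambda>_. 1"]) simp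
next
  case (3 x y zs)
  then obtain f where f: "\<forall>i. 0 < f i" "successively (\<lambda>i j. f i = a i j * f j) (y # zs)"
    "f (last (y # zs)) = 1" "f y = (\<Prod>(i, j)\<leftarrow>zip (y # zs) zs. a i j)"
    by auto
  \<comment> \<open>By distinctness \<open>x\<close> is not in \<open>y # zs\<close>, so the update
    leaves the earlier equations intact.\<close>
  define g where "g = f(x := a x y * f y)"
  have "successively (\<lambda>i j. g i = a i j * g j) (y # zs)"
    by (rule successively_mono[OF f(2)]) (use 3(4) in \<open>auto simp: g_def\<close>)
  moreover have "0 < g i" for i using f(1) pos by (simp add: g_def)
  ultimately show ?case
    using f(3,4) 3(4) by (intro exI[of _ g]) (auto simp: g_def)
qed simp

section \<open>Efficient vectors\<close>

lemma reciprocal_efficiency_total: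
  assumes "reciprocal_matrix A" "w \<in> positive_vectors"
  shows "A $ i $ j * w $ j \<le> w $ i \<or> A $ j $ i * w $ i \<le> w $ j"
proof -
  have "0 < A $ i $ j" "A $ j $ i = 1 / A $ i $ j"
    using assms(1) unfolding reciprocal_matrix_def by blast+
  then show ?thesis by (simp add: pos_divide_le_eq mult.commute linear)
qed

text \<open>If the inequality held for all pairs, those for \<open>(i, j)\<close> and
  \<open>(j, i)\<close> would combine by reciprocity to
  \<open>A $ i $ j = w $ i / w $ j\<close>.\<close>

lemma inconsistent_imp_strict:
  assumes rec: "reciprocal_matrix A" and "\<not> consistent_matrix A" and w: "w \<in> positive_vectors"
  shows "\<exists>i j. \<not> A $ i $ j * w $ j \<le> w $ i"
proof (rule ccontr)
  assume "\<not> ?thesis"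
  then have le: "A $ i $ j * w $ j \<le> w $ i" for i j by blast
  have "A $ i $ j = w $ i / w $ j" for i j
  proof -
    have "0 < A $ i $ j" "A $ j $ i = 1 / A $ i $ j" "0 < w $ j"
      using rec w unfolding reciprocal_matrix_def positive_vectors_def by blast+
    moreover from this have "w $ i \<le> A $ i $ j * w $ j"
      using le[of j i] by (simp add: pos_divide_le_eq mult.commute)
    ultimately show ?thesis using le[of i j] by (simp add: eq_divide_eq)
  qed
  then show False
    using assms(2) w by (simp add: consistent_matrix_def vec_eq_iff) blast
qed

text \<open>
  If no arc leaves \<open>U\<close>, the entries of \<open>w\<close> on \<open>U\<close> can be scaled up, improving every ratio across the cut.
\<close>

lemma efficient_imp_arc_leaving:
  assumes rec: "reciprocal_matrix A" and eff: "w \<in> efficient_vectors A"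
    and U: "a \<in> U" "b \<notin> U"
  shows "\<exists>i\<in>U. \<exists>j\<in>- U. A $ i $ j * w $ j \<le> w $ i"
proof (rule ccontr)
  assume no: "\<not> ?thesis"
  have w: "0 < w $ i" for i using eff by (auto simp: efficient_vectors_def positive_vectors_def)
  have A: "0 < A $ i $ j" "A $ j $ i = 1 / A $ i $ j" for i j
    using rec unfolding reciprocal_matrix_def by blast+
  define M where "M = (\<lambda>(i, j). A $ i $ j * w $ j / w $ i) ` (U \<times> - U)"
  \<comment> \<open>The largest factor that keeps every scaled ratio from \<open>U\<close> to its
    complement at or below the entry of \<open>A\<close>; it exceeds 1 as no arc leaves
    \<open>U\<close>.\<close>
  define c where "c = Min M"
  have M: "finite M" "M \<noteq> {}" using U by (auto simp: M_def)
  have "1 < m" if "m \<in> M" for m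
    using that no w by (force simp: M_def not_le)
  then have c: "1 < c" using M by (simp add: c_def)
  have c_le: "c * w $ i \<le> A $ i $ j * w $ j" if "i \<in> U" "j \<notin> U" for i j
  proof -
    have "c \<le> A $ i $ j * w $ j / w $ i"
      unfolding c_def using M that by (intro Min_le) (auto simp: M_def)
    then show ?thesis using w[of i] by (simp add: field_simps)
  qed
  define v where "v = (\<chi> i. if i \<in> U then c * w $ i else w $ i)"
  have "v \<in> positive_vectors" using w c by (auto simp: v_def positive_vectors_def)
  moreover have "\<bar>A $ i $ j - v $ i / v $ j\<bar> \<le> \<bar>A $ i $ j - w $ i / w $ j\<bar>" for i j
  proof -
    consider "i \<in> U \<longleftrightarrow> j \<in> U" | "i \<in> U" "j \<notin> U" | "i \<notin> U" "j \<in> U" by blast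
    then show ?thesis
    proof cases
      case 1
      then show ?thesis using c by (auto simp: v_def)
    next
      case 2
      have "w $ i / w $ j \<le> c * w $ i / w $ j"
        using c w by (intro divide_right_mono) (auto simp: less_imp_le)
      moreover have "c * w $ i / w $ j \<le> A $ i $ j"
        using c_le[OF 2] w[of j] by (simp add: field_simps)
      ultimately show ?thesis using 2 by (simp add: v_def)
    next
      case 3
      have "w $ i / (c * w $ j) \<le> w $ i / w $ j"
        using c w[of i] w[of j] by (intro divide_left_mono) auto
      moreover have "A $ i $ j \<le> w $ i / (c * w $ j)"
      proof -
        \<comment> \<open>The bound for the opposite pair \<open>(j, i)\<close> carries over because
          \<open>A $ i $ j * A $ j $ i = 1\<close>.\<close>
        have "A $ i $ j * (c * w $ j) \<le> A $ i $ j * (A $ j $ i * w $ i)"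
          using c_le[OF 3(2,1)] A(1)[of i j] by (intro mult_left_mono) auto
        also have "\<dots> = w $ i" using A(1)[of i j] A(2)[where i = i and j = j] by simp
        finally show ?thesis using w[of j] c by (simp add: pos_le_divide_eq)
      qed
      ultimately show ?thesis using 3 by (simp add: v_def)
    qed
  qed
  ultimately obtain d where "v = d *\<^sub>R w" using eff unfolding efficient_vectors_def by blast
  then have "v $ a = d * w $ a" "v $ b = d * w $ b" by simp_all
  then show False using U c w[of a] w[of b] by (simp add: v_def)
qed

lemma efficient_imp_strongly_connected:
  assumes "reciprocal_matrix A" "w \<in> efficient_vectors A"
  shows "(\<lambda>i j. A $ i $ j * w $ j \<le> w $ i)\<^sup>*\<^sup>* a b"
    (is "?R\<^sup>*\<^sup>* a b")
proof (rule ccontr)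
  assume "\<not> ?R\<^sup>*\<^sup>* a b"
  \<comment> \<open>The cut is the set of vertices reachable from \<open>a\<close>, which no arc can
    leave.\<close>
  then obtain i j where "?R\<^sup>*\<^sup>* a i" "\<not> ?R\<^sup>*\<^sup>* a j" "?R i j"
    using efficient_imp_arc_leaving[OF assms, of a "{x. ?R\<^sup>*\<^sup>* a x}" b] by auto
  then show False by (meson rtranclp.rtrancl_into_rtrancl)
qed

section \<open>Vectors whose digraph contains a given cycle\<close>

lemma convex_cycle_vectors: "convex (cycle_vectors A C)"
proof (rule convexI)
  fix x y :: "real ^ 'a" and u v :: real
  assume x: "x \<in> cycle_vectors A C" and y: "y \<in> cycle_vectors A C"
    and uv: "0 \<le> u" "0 \<le> v" "u + v = 1"
  have "0 < u * x $ i + v * y $ i" for i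
  proof -
    have "0 < x $ i" "0 < y $ i" using x y by (auto simp: cycle_vectors_def positive_vectors_def)
    then show ?thesis using uv
      by (metis add_0 add_nonneg_pos add_pos_nonneg less_eq_real_def mult_nonneg_nonneg mult_pos_pos
          zero_neq_one)
  qed
  \<comment> \<open>For a fixed arc the condition is a linear inequality in the vector.\<close>
  moreover have "A $ i $ j * (u * x $ j + v * y $ j) \<le> u * x $ i + v * y $ i"
    if "A $ i $ j * x $ j \<le> x $ i" "A $ i $ j * y $ j \<le> y $ i" for i j
    using mult_left_mono[OF that(1) uv(1)] mult_left_mono[OF that(2) uv(2)]
    by (simp add: algebra_simps)
  ultimately show "u *\<^sub>R x + v *\<^sub>R y \<in> cycle_vectors A C"
    using x y unfolding cycle_vectors_def positive_vectors_def efficiency_digraph_def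
    by (simp add: subset_iff)
qed

text \<open>
  Along an arc \<open>i \<rightarrow> j\<close> of the digraph, a vector \<open>v\<close> at least as good as \<open>w\<close> satisfies
  \<open>v\<^sub>i / w\<^sub>i \<le> v\<^sub>j / w\<^sub>j\<close>; around a Hamiltonian cycle all these ratios coincide.
\<close>

lemma cycle_vectors_subset_efficient:
  assumes "hamiltonian_cycle full_digraph C"
  shows "cycle_vectors A C \<subseteq> efficient_vectors A"
proof
  fix w assume w: "w \<in> cycle_vectors A C"
  then have pos: "0 < w $ i" for i by (auto simp: cycle_vectors_def positive_vectors_def)
  obtain xs where xs: "xs \<noteq> []" "set xs = UNIV" and C: "C = zip xs (rotate1 xs)"
    using assms by (auto simp: hamiltonian_cycle_iff full_digraph_def)
  have "\<exists>c>0. v = c *\<^sub>R w"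
    if v: "v \<in> positive_vectors"
      and le: "\<forall>i j. \<bar>A $ i $ j - v $ i / v $ j\<bar> \<le> \<bar>A $ i $ j - w $ i / w $ j\<bar>" for v
  proof -
    have vpos: "0 < v $ i" for i using v by (auto simp: positive_vectors_def)
    define r where "r i = v $ i / w $ i" for i
    have "r i \<le> r j" if "(i, j) \<in> set C" for i j
    proof -
      have "A $ i $ j * w $ j \<le> w $ i"
        using w that by (auto simp: cycle_vectors_def efficiency_digraph_def)
      then have "A $ i $ j \<le> w $ i / w $ j" using pos[of j] by (simp add: field_simps)
      \<comment> \<open>The ratio of \<open>w\<close> lies at or above the entry, so a ratio of
        \<open>v\<close> that is no farther away cannot exceed it.\<close>
      then have "v $ i / v $ j \<le> w $ i / w $ j" using le[rule_format, of i j] by linarith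
      then show ?thesis using pos[of i] pos[of j] vpos[of j] by (simp add: r_def field_simps)
    qed
    then have arcs: "\<forall>(i, j)\<in>set (zip xs (tl xs)). r i \<le> r j" "r (last xs) \<le> r (hd xs)"
      unfolding C zip_rotate1[OF xs(1)] by auto
    then have "successively (\<lambda>i j. r i \<le> r j) xs"
      by (simp add: set_zip_tl_iff_successively)
    then have "sorted (map r xs)"
      by (simp add: sorted_wrt_map successively_conv_sorted_wrt transp_def)
    then have "r (hd xs) \<le> r i \<and> r i \<le> r (last xs)" for i
    proof -
      have "r i \<in> set (map r xs)" using xs(2) by simp
      then show ?thesis
        using \<open>sorted (map r xs)\<close> xs(1)
        by (auto simp: in_set_conv_nth sorted_iff_nth_mono hd_conv_nth last_conv_nth)
    qed
    then have r_const: "r i = r (hd xs)" for i using arcs(2) by (meson order_antisym order_trans)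
    have "v $ i = r (hd xs) * w $ i" for i
      unfolding r_const[of i, symmetric] using pos[of i] by (simp add: r_def)
    then have "v = r (hd xs) *\<^sub>R w" by (simp add: vec_eq_iff)
    moreover have "0 < r (hd xs)" using pos vpos by (simp add: r_def)
    ultimately show ?thesis by blast
  qed
  then show "w \<in> efficient_vectors A"
    using w unfolding efficient_vectors_def cycle_vectors_def by blast
qed

lemma cycle_vectors_nonempty:
  assumes rec: "reciprocal_matrix A" and C: "C \<in> cycles_le_one A"
  shows "cycle_vectors A C \<noteq> {}"
proof -
  obtain xs where xs: "xs \<noteq> []" "distinct xs" and Cxs: "C = zip xs (rotate1 xs)"
    and loopfree: "\<And>i j. (i, j) \<in> set C \<Longrightarrow> i \<noteq> j"
    using C by (auto simp: cycles_le_one_def hamiltonian_cycle_iff full_digraph_def)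
  have A: "0 < A $ i $ j" for i j using rec unfolding reciprocal_matrix_def by blast+
  obtain f where f: "\<forall>i. 0 < f i" "successively (\<lambda>i j. f i = A $ i $ j * f j) xs" "f (last xs) = 1"
    "f (hd xs) = (\<Prod>(i, j)\<leftarrow>zip xs (tl xs). A $ i $ j)"
    using path_weights[where a = "\<lambda>i j. A $ i $ j", OF A xs] by blast
  have "cycle_product A C \<le> 1" using C by (simp add: cycles_le_one_def)
  \<comment> \<open>The path arcs hold with equality; the closing arc is exactly the bound on the
    cycle product.\<close>
  then have "A $ last xs $ hd xs * f (hd xs) \<le> f (last xs)"
    by (simp add: cycle_product_def Cxs zip_rotate1[OF xs(1)] f(3,4) mult.commute)
  moreover have "\<forall>(i, j)\<in>set (zip xs (tl xs)). f i = A $ i $ j * f j"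
    using f(2) by (simp add: set_zip_tl_iff_successively)
  ultimately have "A $ i $ j * f j \<le> f i" if "(i, j) \<in> set C" for i j
    using that unfolding Cxs zip_rotate1[OF xs(1)] by auto
  then have "(\<chi> i. f i) \<in> cycle_vectors A C"
    using f(1) by (auto simp: cycle_vectors_def positive_vectors_def efficiency_digraph_def
        dest: loopfree)
  then show ?thesis by blast
qed

section \<open>Bounds on cycle products\<close>

lemma cycle_product_le_one:
  assumes rec: "reciprocal_matrix A" and w: "w \<in> positive_vectors"
    and arcs: "\<And>i j. (i, j) \<in> set (zip xs (rotate1 xs)) \<Longrightarrow> A $ i $ j * w $ j \<le> w $ i"
  shows "cycle_product A (zip xs (rotate1 xs)) \<le> 1"
proof -
  have pos: "0 < A $ i $ j" "0 < w $ j" for i j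
    using rec w unfolding reciprocal_matrix_def positive_vectors_def by blast+
  have "cycle_product A (zip xs (rotate1 xs)) \<le> (\<Prod>(i, j)\<leftarrow>zip xs (rotate1 xs). w $ i / w $ j)"
    unfolding cycle_product_def
    by (rule prod_list_mono_real) (use arcs pos in \<open>auto simp: field_simps\<close>)
  also have "\<dots> = 1"
    by (rule prod_list_cycle_quotients) (use pos(2) in \<open>simp add: less_imp_neq[symmetric]\<close>)
  finally show ?thesis .
qed

text \<open>The closing arc is split off: the path part gives \<open>p \<le> q\<close>, and the
  strict closing factor, multiplied by \<open>p > 0\<close>, makes the whole bound strict.\<close>

lemma strict_cycle_product_less_one:
  assumes rec: "reciprocal_matrix A" and w: "w \<in> positive_vectors"
    and xs: "strict_cycle (\<lambda>i j. A $ i $ j * w $ j \<le> w $ i) xs"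
  shows "cycle_product A (zip xs (rotate1 xs)) < 1"
proof -
  have pos: "0 < A $ i $ j" "0 < w $ j" and recip: "A $ j $ i = 1 / A $ i $ j" for i j
    using rec w unfolding reciprocal_matrix_def positive_vectors_def by blast+
  have ne: "xs \<noteq> []" and succ: "successively (\<lambda>i j. A $ i $ j * w $ j \<le> w $ i) xs"
    and strict: "\<not> A $ hd xs $ last xs * w $ last xs \<le> w $ hd xs"
    using xs by (auto simp: strict_cycle_def)
  define p q where "p = (\<Prod>(i, j)\<leftarrow>zip xs (tl xs). A $ i $ j)"
    and "q = (\<Prod>(i, j)\<leftarrow>zip xs (tl xs). w $ i / w $ j)"
  have "0 < p" unfolding p_def by (rule prod_list_pos) (use pos in auto)
  have "p \<le> q"
    unfolding p_def q_def
    by (rule prod_list_mono_real)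
      (use succ[folded set_zip_tl_iff_successively] pos in \<open>fastforce simp: field_simps\<close>)
  have "A $ last xs $ hd xs < w $ last xs / w $ hd xs"
    using strict pos recip[of "last xs" "hd xs"] by (simp add: field_simps)
  then have "p * A $ last xs $ hd xs < p * (w $ last xs / w $ hd xs)"
    using \<open>0 < p\<close> by (rule mult_strict_left_mono)
  also have "\<dots> \<le> q * (w $ last xs / w $ hd xs)"
    using \<open>p \<le> q\<close> pos by (intro mult_right_mono) (auto simp: less_imp_le)
  also have "\<dots> = (\<Prod>(i, j)\<leftarrow>zip xs (rotate1 xs). w $ i / w $ j)"
    by (simp add: zip_rotate1[OF ne] q_def)
  also have "\<dots> = 1"
    by (rule prod_list_cycle_quotients) (use pos(2) in \<open>simp add: less_imp_neq[symmetric]\<close>)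
  finally show ?thesis by (simp add: cycle_product_def zip_rotate1[OF ne] p_def)
qed

lemma efficient_imp_cycle_less_one:
  assumes rec: "reciprocal_matrix A" and incons: "\<not> consistent_matrix A"
    and eff: "w \<in> efficient_vectors A"
  shows "\<exists>C\<in>cycles_less_one A. w \<in> cycle_vectors A C"
proof -
  let ?R = "\<lambda>i j. A $ i $ j * w $ j \<le> w $ i"
  have w: "w \<in> positive_vectors" using eff by (simp add: efficient_vectors_def)
  obtain xs where xs: "strict_cycle ?R xs" "set xs = UNIV"
    using strongly_connected_total_strict_hamiltonian[of ?R]
      reciprocal_efficiency_total[OF rec w] efficient_imp_strongly_connected[OF rec eff]
      inconsistent_imp_strict[OF rec incons w] by blast
  have ne: "xs \<noteq> []" and dist: "distinct xs" and succ: "successively ?R xs"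
    and strict: "\<not> ?R (hd xs) (last xs)"
    using xs by (auto simp: strict_cycle_def)
  define C where "C = zip xs (rotate1 xs)"
  have "successively (\<noteq>) xs"
    using dist by (induction xs rule: induct_list012) auto
  \<comment> \<open>Loops are not arcs of the digraphs, so the ends must differ; they do, since
    totality makes the relation reflexive.\<close>
  moreover have "?R (last xs) (hd xs)" "last xs \<noteq> hd xs"
    using strict reciprocal_efficiency_total[OF rec w] by metis+
  ultimately have arcs: "i \<noteq> j \<and> ?R i j" if "(i, j) \<in> set C" for i j
    using that succ ne
    by (auto simp: C_def zip_rotate1 simp flip: set_zip_tl_iff_successively)
  then have "hamiltonian_cycle full_digraph C"
    using ne dist xs(2) by (auto simp: hamiltonian_cycle_iff full_digraph_def C_def)
  then have "C \<in> cycles_less_one A"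
    using strict_cycle_product_less_one[OF rec w xs(1)] by (simp add: cycles_less_one_def C_def)
  moreover have "w \<in> cycle_vectors A C"
    using w arcs by (auto simp: cycle_vectors_def efficiency_digraph_def)
  ultimately show ?thesis by blast
qed

theorem theorem8:
  fixes A :: "real ^ 'n ^ 'n"
  assumes "reciprocal_matrix A"
    and "\<not> consistent_matrix A"
  shows "(\<forall>w\<in>efficient_vectors A. \<forall>C.
            hamiltonian_cycle (efficiency_digraph A w) C \<longrightarrow> C \<in> cycles_le_one A)
       \<and> (\<forall>C\<in>cycles_le_one A.
            cycle_vectors A C \<noteq> {} \<and> convex (cycle_vectors A C)
              \<and> cycle_vectors A C \<subseteq> efficient_vectors A)
       \<and> efficient_vectors A = (\<Union>C\<in>cycles_less_one A. cycle_vectors A C)"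
proof (intro conjI ballI allI impI)
  fix w C
  assume w: "w \<in> efficient_vectors A" and C: "hamiltonian_cycle (efficiency_digraph A w) C"
  then obtain xs where xs: "xs \<noteq> []" "distinct xs" "set xs = UNIV" "C = zip xs (rotate1 xs)"
    "set C \<subseteq> parcs (efficiency_digraph A w)"
    by (auto simp: hamiltonian_cycle_iff efficiency_digraph_def)
  have "hamiltonian_cycle full_digraph C"
    using xs by (auto simp: hamiltonian_cycle_iff full_digraph_def efficiency_digraph_def)
  moreover have "cycle_product A C \<le> 1"
    unfolding xs(4)
    by (rule cycle_product_le_one[OF assms(1), of w])
      (use w xs(4,5) in \<open>auto simp: efficient_vectors_def efficiency_digraph_def\<close>)
  ultimately show "C \<in> cycles_le_one A" by (simp add: cycles_le_one_def)
next
  fix C assume C: "C \<in> cycles_le_one A"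
  show "cycle_vectors A C \<noteq> {}" by (rule cycle_vectors_nonempty[OF assms(1) C])
  show "convex (cycle_vectors A C)" by (rule convex_cycle_vectors)
  show "cycle_vectors A C \<subseteq> efficient_vectors A"
    using C by (intro cycle_vectors_subset_efficient) (simp add: cycles_le_one_def)
next
  show "efficient_vectors A = (\<Union>C\<in>cycles_less_one A. cycle_vectors A C)"
  proof
    show "efficient_vectors A \<subseteq> (\<Union>C\<in>cycles_less_one A. cycle_vectors A C)"
      using efficient_imp_cycle_less_one[OF assms] by blast
    show "(\<Union>C\<in>cycles_less_one A. cycle_vectors A C) \<subseteq> efficient_vectors A"
      by (intro UN_least cycle_vectors_subset_efficient) (simp add: cycles_less_one_def)
  qed
qed

end
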